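(* (a) For every cutting $P$ of the pizza, Alice has a zero-jump strategy with gain $|P|/3$, and the constant $1/3$ is best possible: for every $c>1/3$ there is a cutting $P$ for which Alice has no zero-jump strategy with gain $c|P|$. (b) For every cutting $P$ of the pizza, Alice has a one-jump strategy with gain $7|P|/16$, and the constant $7/16$ is best possible: for every $c>7/16$ there is a cutting $P$ for which Alice has no one-jump strategy with gain $c|P|$.
   Context: The pizza game: a pizza is cut into $n\ge1$ slices forming a circular sequence $P=p_0p_1\dots p_{n-1}$ (indices modulo $n$, $p_i$ adjacent to $p_{i\pm1}$), each slice having a size $|p_i|\ge 0$; $|P|=\sum_i|p_i|$. Alice and Bob alternately take slices, one per turn, Alice first. In the first turn Alice may take any slice; in every later turn the player must take a slice that has a neighbor already taken. For $1<j\le n$, if a player took $p_i$ in turn $j-1$ and the other player takes $p_{i-1}$ or $p_{i+1}$ in turn $j$, turn $j$ is a shift; otherwise it is a jump. A strategy of a player is a $j$-jump strategy if it makes at most $j$ jumps of that player. A strategy has gain $g$ if it guarantees the player a set of slices of total size at least $g$, whatever the opponent does. *)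

theory Defs
  imports Complex_Main
begin

text \<open>
  A cutting is the list of sizes of its slices in circular order. Slices are the indices
  below the length \<open>n\<close> of that list, and a play is the list of slices in the order in which they are
  taken, so that turn \<open>j\<close> of the game is position \<open>t = j - 1\<close> of the list.
\<close>

datatype player = Alice | Bob

definition mover :: "nat \<Rightarrow> player" where
  "mover t = (if even t then Alice else Bob)"

definition cutting :: "real list \<Rightarrow> bool" where
  "cutting P \<longleftrightarrow> P \<noteq> [] \<and> (\<forall>x \<in> set P. 0 \<le> x)"

text \<open>Only meant for slices \<open>i, k < n\<close>.\<close>

definition neighbor :: "nat \<Rightarrow> nat \<Rightarrow> nat \<Rightarrow> bool" where
  "neighbor n i k \<longleftrightarrow> k = (i + 1) mod n \<or> i = (k + 1) mod n"

definition legal_move :: "nat \<Rightarrow> nat list \<Rightarrow> nat \<Rightarrow> bool" where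
  "legal_move n xs x \<longleftrightarrow>
     x < n \<and> x \<notin> set xs \<and> (xs = [] \<or> (\<exists>y \<in> set xs. neighbor n y x))"

definition play :: "nat \<Rightarrow> nat list \<Rightarrow> bool" where
  "play n xs \<longleftrightarrow> (\<forall>t < length xs. legal_move n (take t xs) (xs ! t))"

definition complete_play :: "nat \<Rightarrow> nat list \<Rightarrow> bool" where
  "complete_play n xs \<longleftrightarrow> play n xs \<and> length xs = n"

text \<open>
  Strategies may depend on the whole history of the game. Their values are relevant only on
  histories that are consistent with the strategy and in which it is the player's turn.
\<close>

type_synonym strategy = "nat list \<Rightarrow> nat"

definition follows :: "player \<Rightarrow> strategy \<Rightarrow> nat list \<Rightarrow> bool" where
  "follows pl s xs \<longleftrightarrow> (\<forall>t < length xs. mover t = pl \<longrightarrow> xs ! t = s (take t xs))"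

definition valid_strategy :: "nat \<Rightarrow> player \<Rightarrow> strategy \<Rightarrow> bool" where
  "valid_strategy n pl s \<longleftrightarrow>
     (\<forall>xs. play n xs \<and> follows pl s xs \<and> length xs < n \<and> mover (length xs) = pl
        \<longrightarrow> legal_move n xs (s xs))"

text \<open>The first turn is neither a shift nor a jump.\<close>

definition is_shift :: "nat \<Rightarrow> nat list \<Rightarrow> nat \<Rightarrow> bool" where
  "is_shift n xs t \<longleftrightarrow> 0 < t \<and> t < length xs \<and> neighbor n (xs ! (t - 1)) (xs ! t)"

definition is_jump :: "nat \<Rightarrow> nat list \<Rightarrow> nat \<Rightarrow> bool" where
  "is_jump n xs t \<longleftrightarrow> 0 < t \<and> t < length xs \<and> \<not> is_shift n xs t"

definition jumps :: "nat \<Rightarrow> player \<Rightarrow> nat list \<Rightarrow> nat" where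
  "jumps n pl xs = card {t. t < length xs \<and> mover t = pl \<and> is_jump n xs t}"

definition jump_strategy :: "nat \<Rightarrow> player \<Rightarrow> nat \<Rightarrow> strategy \<Rightarrow> bool" where
  "jump_strategy n pl j s \<longleftrightarrow>
     valid_strategy n pl s \<and>
     (\<forall>xs. complete_play n xs \<and> follows pl s xs \<longrightarrow> jumps n pl xs \<le> j)"

definition gain :: "real list \<Rightarrow> player \<Rightarrow> nat list \<Rightarrow> real" where
  "gain P pl xs = (\<Sum>t | t < length xs \<and> mover t = pl. P ! (xs ! t))"

definition has_gain :: "real list \<Rightarrow> player \<Rightarrow> strategy \<Rightarrow> real \<Rightarrow> bool" where
  "has_gain P pl s g \<longleftrightarrow>
     (\<forall>xs. complete_play (length P) xs \<and> follows pl s xs \<longrightarrow> g \<le> gain P pl xs)"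

end

(*
  If n is even, Alice gets a parity class of slices without jumping, and one of the two classes is
  worth half of the pizza. Let n = 2m + 1 and number the slices by w(0), w(2), w(4), ... modulo n.
  In this order the slices taken by a player who only shifts are consecutive, so a zero-jump
  strategy that starts at v secures the least of the half circles [h, h + m] that contain v. If it
  never secures g, then every v lies in a half circle of size below g. Three of them cover the pizza,
  which gives the constant 1/3.

  For one jump choose such a triple of half circles x, y, z with minimal sum. Then every half
  circle h with z - m <= h <= y + m is at least as large as the smaller of y and z. Alice starts
  somewhere in the arc B = [z - m, y), shifts as long as she stays in a chosen subarc of it, and jumps
  when Bob leaves the subarc. If all these strategies fail, then linear inequalities hold between
  the sizes of B, of the overlap of y and z and of the smaller of y and z. Those of the three
  rotations of the triple are inconsistent when g is 7/16 of the pizza.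

  Both constants are attained by an explicit pizza, with 9 and 23 slices.
*)
theory Submission
  imports Defs
begin

section \<open>Strategies and the reduced game\<close>

lemma play_snoc: "play n (xs @ [x]) \<longleftrightarrow> play n xs \<and> legal_move n xs x"
  unfolding play_def by (auto simp: nth_append less_Suc_eq)

lemma follows_snoc:
  "follows pl s (xs @ [x]) \<longleftrightarrow> follows pl s xs \<and> (mover (length xs) = pl \<longrightarrow> x = s xs)"
  unfolding follows_def by (auto simp: nth_append less_Suc_eq)

lemma gain_snoc:
  "gain P pl (xs @ [x]) = gain P pl xs + (if mover (length xs) = pl then P ! x else 0)"
proof -
  have "{t. t < length (xs @ [x]) \<and> mover t = pl} =
      {t. t < length xs \<and> mover t = pl} \<union> (if mover (length xs) = pl then {length xs} else {})"
    by (auto simp: less_Suc_eq)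
  moreover have "(\<Sum>t | t < length xs \<and> mover t = pl. P ! ((xs @ [x]) ! t)) = gain P pl xs"
    unfolding gain_def by (intro sum.cong) (auto simp: nth_append)
  ultimately show ?thesis
    unfolding gain_def[of P pl "xs @ [x]"] by (simp add: sum.union_disjoint)
qed

lemma jumps_snoc:
  "jumps n pl (xs @ [x]) = jumps n pl xs +
     (if mover (length xs) = pl \<and> xs \<noteq> [] \<and> \<not> neighbor n (last xs) x then 1 else 0)"
proof -
  let ?c = "mover (length xs) = pl \<and> xs \<noteq> [] \<and> \<not> neighbor n (last xs) x"
  have "is_jump n (xs @ [x]) t \<longleftrightarrow> (if t < length xs then is_jump n xs t
      else t = length xs \<and> xs \<noteq> [] \<and> \<not> neighbor n (last xs) x)" for t
    unfolding is_jump_def is_shift_def by (auto simp: nth_append last_conv_nth less_Suc_eq)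
  then have "{t. t < length (xs @ [x]) \<and> mover t = pl \<and> is_jump n (xs @ [x]) t} =
      {t. t < length xs \<and> mover t = pl \<and> is_jump n xs t} \<union> (if ?c then {length xs} else {})"
    by (auto split: if_splits)
  then show ?thesis
    unfolding jumps_def by (simp add: card_Un_disjoint)
qed

section \<open>Slices addressed by integers, so that the taken slices form an interval\<close>

definition idx :: "nat \<Rightarrow> int \<Rightarrow> nat" where
  "idx n i = nat (i mod int n)"

lemma idx_less: "0 < n \<Longrightarrow> idx n i < n"
  unfolding idx_def by (simp add: nat_less_iff)

lemma idx_of_nat: "x < n \<Longrightarrow> idx n (int x) = x"
  unfolding idx_def by simp

lemma idx_eq_iff: "0 < n \<Longrightarrow> idx n i = idx n k \<longleftrightarrow> int n dvd i - k"
  unfolding idx_def by (simp add: eq_nat_nat_iff mod_eq_dvd_iff)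

lemma idx_Suc: "0 < n \<Longrightarrow> (idx n i + 1) mod n = idx n (i + 1)"
proof -
  assume n: "0 < n"
  have "int ((idx n i + 1) mod n) = int (idx n (i + 1))"
    using n unfolding idx_def by (simp add: zmod_int mod_simps add.commute)
  then show ?thesis by (simp only: of_nat_eq_iff)
qed

lemma neighbor_idx:
  assumes "0 < n"
  shows "neighbor n (idx n i) (idx n k) \<longleftrightarrow> int n dvd k - (i + 1) \<or> int n dvd i - (k + 1)"
  unfolding neighbor_def idx_Suc[OF assms] idx_eq_iff[OF assms] ..

lemma idx_notin:
  assumes "0 < n" "lo \<le> hi" "hi - lo + 1 < int n"
  shows "idx n (hi + 1) \<notin> idx n ` {lo..hi}" "idx n (lo - 1) \<notin> idx n ` {lo..hi}"
proof -
  have "idx n (hi + 1) \<noteq> idx n i \<and> idx n (lo - 1) \<noteq> idx n i" if i: "i \<in> {lo..hi}" for i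
  proof -
    have "\<not> int n dvd hi + 1 - i" using zdvd_imp_le[of "int n" "hi + 1 - i"] i assms(3) by auto
    moreover have "\<not> int n dvd i - (lo - 1)"
      using zdvd_imp_le[of "int n" "i - (lo - 1)"] i assms(3) by auto
    ultimately show ?thesis unfolding idx_eq_iff[OF assms(1)] by (metis dvd_diff_commute)
  qed
  then show "idx n (hi + 1) \<notin> idx n ` {lo..hi}" "idx n (lo - 1) \<notin> idx n ` {lo..hi}" by blast+
qed

text \<open>Inside the interval every neighbor is taken, so only the slices just outside the two
  ends remain. When a single slice is left, both ends denote it.\<close>

lemma legal_move_interval:
  assumes n: "0 < n" and S: "set xs = idx n ` {lo..hi}" and "lo \<le> hi" "hi - lo + 1 < int n"
  shows "legal_move n xs x \<longleftrightarrow> x = idx n (hi + 1) \<or> x = idx n (lo - 1)"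
proof
  have ne: "xs \<noteq> []" using S \<open>lo \<le> hi\<close> by auto
  {
    assume "legal_move n xs x"
    then obtain y where x: "x < n" "x \<notin> set xs" and y: "y \<in> set xs" "neighbor n y x"
      using ne unfolding legal_move_def by auto
    from y S obtain i where i: "i \<in> {lo..hi}" "y = idx n i" by auto
    have "neighbor n (idx n i) (idx n (int x))"
      using y i x by (simp add: idx_of_nat)
    then have "idx n (int x) = idx n (i + 1) \<or> idx n (int x) = idx n (i - 1)"
      unfolding neighbor_idx[OF n] idx_eq_iff[OF n]
      by (metis diff_diff_eq2 dvd_diff_commute)
    then have "x = idx n (i + 1) \<or> x = idx n (i - 1)"
      using x by (simp add: idx_of_nat)
    moreover have "idx n (i + 1) \<in> set xs" if "i \<noteq> hi" using that i S by auto
    moreover have "idx n (i - 1) \<in> set xs" if "i \<noteq> lo" using that i S by auto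
    ultimately show "x = idx n (hi + 1) \<or> x = idx n (lo - 1)" using x by auto
  }
  {
    assume x: "x = idx n (hi + 1) \<or> x = idx n (lo - 1)"
    have "neighbor n (idx n hi) (idx n (hi + 1))" "neighbor n (idx n lo) (idx n (lo - 1))"
      unfolding neighbor_idx[OF n] by auto
    then have "\<exists>y \<in> set xs. neighbor n y x"
      using x S \<open>lo \<le> hi\<close> by auto
    moreover have "x < n" using x idx_less[OF n] by auto
    moreover have "x \<notin> set xs" using x S idx_notin[OF n assms(3,4)] by metis
    ultimately show "legal_move n xs x" unfolding legal_move_def by auto
  }
qed

section \<open>The reduced game and its relation to strategies\<close>

text \<open>
  The game seen from a position in which the slices \<open>lo, \<dots>, hi\<close> are taken and Bob is to move: \<open>k\<close>
  rounds are left, Alice may still jump \<open>j\<close> times, and she holds \<open>a\<close>.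
\<close>

fun alice_wins :: "(int \<Rightarrow> real) \<Rightarrow> real \<Rightarrow> nat \<Rightarrow> int \<Rightarrow> int \<Rightarrow> nat \<Rightarrow> real \<Rightarrow> bool" where
  "alice_wins w g 0 lo hi j a \<longleftrightarrow> g \<le> a"
| "alice_wins w g (Suc k) lo hi j a \<longleftrightarrow>
     (alice_wins w g k lo (hi + 2) j (a + w (hi + 2)) \<or>
      0 < j \<and> alice_wins w g k (lo - 1) (hi + 1) (j - 1) (a + w (lo - 1))) \<and>
     (alice_wins w g k (lo - 2) hi j (a + w (lo - 2)) \<or>
      0 < j \<and> alice_wins w g k (lo - 1) (hi + 1) (j - 1) (a + w (hi + 1)))"

lemma image_idx_snoc:
  assumes "lo \<le> hi + 1"
  shows "insert (idx n (hi + 1)) (idx n ` {lo..hi}) = idx n ` {lo..hi + 1}"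
    and "insert (idx n (lo - 1)) (idx n ` {lo..hi}) = idx n ` {lo - 1..hi}"
proof -
  have "{lo..hi + 1} = insert (hi + 1) {lo..hi}" "{lo - 1..hi} = insert (lo - 1) {lo..hi}"
    using assms by auto
  then show "insert (idx n (hi + 1)) (idx n ` {lo..hi}) = idx n ` {lo..hi + 1}"
    and "insert (idx n (lo - 1)) (idx n ` {lo..hi}) = idx n ` {lo - 1..hi}" by auto
qed

text \<open>The strategy picks by \<open>SOME\<close> a move that preserves \<open>I\<close>.
  Induction on the history then gives \<open>I\<close> for every play that follows it, and
  \<open>I\<close> on complete plays bounds jumps and gain.\<close>

lemma strategy_from_invariant:
  assumes "I []"
    and alice: "\<And>xs. \<lbrakk>play n xs; I xs; length xs < n; mover (length xs) = Alice\<rbrakk>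
      \<Longrightarrow> \<exists>x. legal_move n xs x \<and> I (xs @ [x])"
    and bob: "\<And>xs x. \<lbrakk>play n xs; I xs; length xs < n; mover (length xs) = Bob; legal_move n xs x\<rbrakk>
      \<Longrightarrow> I (xs @ [x])"
    and final: "\<And>xs. \<lbrakk>complete_play n xs; I xs\<rbrakk> \<Longrightarrow> jumps n Alice xs \<le> j \<and> g \<le> gain P Alice xs"
    and n: "n = length P"
  shows "\<exists>s. jump_strategy (length P) Alice j s \<and> has_gain P Alice s g"
proof -
  define s where "s xs = (SOME x. legal_move n xs x \<and> I (xs @ [x]))" for xs
  have s: "legal_move n xs (s xs) \<and> I (xs @ [s xs])"
    if "play n xs" "I xs" "length xs < n" "mover (length xs) = Alice" for xs
    unfolding s_def using someI_ex[OF alice[OF that]] .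
  have inv: "play n xs \<Longrightarrow> follows Alice s xs \<Longrightarrow> length xs \<le> n \<Longrightarrow> I xs" for xs
  proof (induction xs rule: rev_induct)
    case Nil
    show ?case by fact
  next
    case (snoc x xs)
    then have "play n xs" "I xs" "length xs < n" "legal_move n xs x"
      by (auto simp: play_snoc follows_snoc)
    then show ?case
      using s bob snoc.prems by (cases "mover (length xs)") (auto simp: follows_snoc)
  qed
  show ?thesis
    unfolding jump_strategy_def has_gain_def valid_strategy_def n[symmetric]
    using inv s final by (intro exI[of _ s]) (auto simp: complete_play_def)
qed

definition slice :: "real list \<Rightarrow> int \<Rightarrow> real" where
  "slice P i = P ! idx (length P) i"

lemma mover_eq [simp]: "mover t = Alice \<longleftrightarrow> even t" "mover t = Bob \<longleftrightarrow> odd t"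
  unfolding mover_def by auto

lemma alice_wins_imp_strategy:
  assumes "P \<noteq> []"
    and start: "alice_wins (slice P) g ((length P - 1) div 2) v v j (slice P v)"
  shows "\<exists>s. jump_strategy (length P) Alice j s \<and> has_gain P Alice s g"
proof -
  define n where "n = length P"
  have n: "0 < n" using assms unfolding n_def by simp
  define w where "w = slice P"
  have w: "w i = P ! idx n i" for i unfolding w_def slice_def n_def ..
  define taken where "taken xs lo hi \<longleftrightarrow> set xs = idx n ` {lo..hi} \<and> int (length xs) = hi - lo + 1"
    for xs :: "nat list" and lo hi :: int
  \<comment> \<open>After a move of Bob, the last slice of the play tells at which end Alice's shift is.\<close>
  define good where "good xs lo hi i \<longleftrightarrow> taken xs lo hi \<and> jumps n Alice xs + i \<le> j \<and>
     (if odd (length xs) then alice_wins w g ((n - length xs) div 2) lo hi i (gain P Alice xs)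
      else if length xs = n then g \<le> gain P Alice xs
      else let k = (n - length xs - 1) div 2 in
       last xs = idx n hi \<and>
         (alice_wins w g k lo (hi + 1) i (gain P Alice xs + w (hi + 1)) \<or>
          0 < i \<and> alice_wins w g k (lo - 1) hi (i - 1) (gain P Alice xs + w (lo - 1))) \<or>
       last xs = idx n lo \<and>
         (alice_wins w g k (lo - 1) hi i (gain P Alice xs + w (lo - 1)) \<or>
          0 < i \<and> alice_wins w g k lo (hi + 1) (i - 1) (gain P Alice xs + w (hi + 1))))"
    for xs lo hi i
  define I where "I xs \<longleftrightarrow> xs = [] \<or> (\<exists>lo hi i. good xs lo hi i)" for xs
  show ?thesis
  proof (rule strategy_from_invariant[of I n])
    show "I []" unfolding I_def by simp
    show "n = length P" by (rule n_def)
  next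
    fix xs assume xs: "play n xs" "I xs" "length xs < n" and "mover (length xs) = Alice"
    then have ev: "even (length xs)" by simp
    show "\<exists>x. legal_move n xs x \<and> I (xs @ [x])"
    proof (cases "xs = []")
      case True
      have "legal_move n [] (idx n v)" using idx_less[OF n] by (simp add: legal_move_def)
      moreover have "taken [idx n v] v v" by (simp add: taken_def)
      moreover have "gain P Alice [idx n v] = w v" "jumps n Alice [idx n v] = 0"
        using gain_snoc[of P Alice "[]"] jumps_snoc[of n Alice "[]"]
        by (auto simp: w gain_def jumps_def)
      ultimately show ?thesis
        using start True unfolding I_def good_def n_def[symmetric] w_def[symmetric]
        by (intro exI[of _ "idx n v"]) (force simp: Let_def)
    next
      case False
      let ?k = "(n - length xs - 1) div 2"
      obtain lo hi i where t: "taken xs lo hi" and j: "jumps n Alice xs + i \<le> j" and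
        cs: "last xs = idx n hi \<and>
         (alice_wins w g ?k lo (hi + 1) i (gain P Alice xs + w (hi + 1)) \<or>
          0 < i \<and> alice_wins w g ?k (lo - 1) hi (i - 1) (gain P Alice xs + w (lo - 1))) \<or>
       last xs = idx n lo \<and>
         (alice_wins w g ?k (lo - 1) hi i (gain P Alice xs + w (lo - 1)) \<or>
          0 < i \<and> alice_wins w g ?k lo (hi + 1) (i - 1) (gain P Alice xs + w (hi + 1)))"
        using xs False ev unfolding I_def good_def by (simp add: Let_def) blast
      have len: "lo \<le> hi" "hi - lo + 1 < int n" "set xs = idx n ` {lo..hi}"
        using t False xs(3) unfolding taken_def by (auto simp flip: length_greater_0_conv)
      have legal: "legal_move n xs (idx n (hi + 1))" "legal_move n xs (idx n (lo - 1))"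
        using legal_move_interval[OF n len(3,1,2)] by auto
      have tk: "taken (xs @ [idx n (hi + 1)]) lo (hi + 1)" "taken (xs @ [idx n (lo - 1)]) (lo - 1) hi"
        using t image_idx_snoc[of lo hi n] len unfolding taken_def by auto
      have g: "gain P Alice (xs @ [idx n x]) = gain P Alice xs + w x" for x
        using ev by (simp add: gain_snoc w)
      have jm: "jumps n Alice (xs @ [x]) \<le> jumps n Alice xs + 1" for x
        by (simp add: jumps_snoc)
      have js: "jumps n Alice (xs @ [idx n (hi + 1)]) = jumps n Alice xs" if "last xs = idx n hi"
        using that by (simp add: jumps_snoc neighbor_idx[OF n])
      have js': "jumps n Alice (xs @ [idx n (lo - 1)]) = jumps n Alice xs" if "last xs = idx n lo"
        using that by (simp add: jumps_snoc neighbor_idx[OF n])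
      \<comment> \<open>Here \<open>i'\<close> is the jump budget after the move: \<open>i\<close>
        for a shift and \<open>i - 1\<close> for a jump.\<close>
      have R: "I (xs @ [idx n (hi + 1)])"
        if "alice_wins w g ?k lo (hi + 1) i' (gain P Alice xs + w (hi + 1))"
          "jumps n Alice (xs @ [idx n (hi + 1)]) + i' \<le> j" for i'
        
      proof -
        have "good (xs @ [idx n (hi + 1)]) lo (hi + 1) i'"
          unfolding good_def using that ev tk(1) by (simp add: g)
        then show ?thesis unfolding I_def by blast
      qed
      have L: "I (xs @ [idx n (lo - 1)])"
        if "alice_wins w g ?k (lo - 1) hi i' (gain P Alice xs + w (lo - 1))"
          "jumps n Alice (xs @ [idx n (lo - 1)]) + i' \<le> j" for i'
        
      proof -
        have "good (xs @ [idx n (lo - 1)]) (lo - 1) hi i'"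
          unfolding good_def using that ev tk(2) by (simp add: g)
        then show ?thesis unfolding I_def by blast
      qed
      have "I (xs @ [idx n (hi + 1)]) \<or> I (xs @ [idx n (lo - 1)])"
        using cs
      proof (elim disjE conjE)
        assume "last xs = idx n hi" "alice_wins w g ?k lo (hi + 1) i (gain P Alice xs + w (hi + 1))"
        then show ?thesis using R[of i] js j by simp
      next
        assume "0 < i" "alice_wins w g ?k (lo - 1) hi (i - 1) (gain P Alice xs + w (lo - 1))"
        then show ?thesis using L[of "i - 1"] jm[of "idx n (lo - 1)"] j by simp
      next
        assume "last xs = idx n lo" "alice_wins w g ?k (lo - 1) hi i (gain P Alice xs + w (lo - 1))"
        then show ?thesis using L[of i] js' j by simp
      next
        assume "0 < i" "alice_wins w g ?k lo (hi + 1) (i - 1) (gain P Alice xs + w (hi + 1))"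
        then show ?thesis using R[of "i - 1"] jm[of "idx n (hi + 1)"] j by simp
      qed
      then show ?thesis using legal by blast
    qed
  next
    fix xs x assume xs: "play n xs" "I xs" "length xs < n" and "mover (length xs) = Bob"
      and x: "legal_move n xs x"
    then have od: "odd (length xs)" by simp
    then have "xs \<noteq> []" by auto
    then obtain lo hi i where t: "taken xs lo hi" and j: "jumps n Alice xs + i \<le> j" and
      aw: "alice_wins w g ((n - length xs) div 2) lo hi i (gain P Alice xs)"
      using xs od unfolding I_def good_def by auto
    have len: "lo \<le> hi" "hi - lo + 1 < int n" "set xs = idx n ` {lo..hi}"
      using t \<open>xs \<noteq> []\<close> xs(3) unfolding taken_def by (auto simp flip: length_greater_0_conv)
    have g: "gain P Alice (xs @ [x]) = gain P Alice xs" using od by (simp add: gain_snoc)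
    have jm: "jumps n Alice (xs @ [x]) = jumps n Alice xs" using od by (simp add: jumps_snoc)
    have tk: "taken (xs @ [idx n (hi + 1)]) lo (hi + 1)" "taken (xs @ [idx n (lo - 1)]) (lo - 1) hi"
      using t image_idx_snoc[of lo hi n] len unfolding taken_def by auto
    have x': "x = idx n (hi + 1) \<or> x = idx n (lo - 1)"
      using legal_move_interval[OF n len(3,1,2)] x by simp
    show "I (xs @ [x])"
    proof (cases "length xs + 1 = n")
      \<comment> \<open>The length is even and Bob takes the last slice. No full round is left, so
        Alice's present gain is final.\<close>
      case True
      then have "g \<le> gain P Alice xs" using aw by auto
      show ?thesis
      proof -
        have "taken (xs @ [x]) lo' hi' \<Longrightarrow> good (xs @ [x]) lo' hi' i" for lo' hi'
          unfolding good_def using True od j \<open>g \<le> gain P Alice xs\<close> by (simp add: g jm)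
        then show ?thesis using x' tk unfolding I_def by blast
      qed
    next
      case False
      then obtain k where k: "(n - length xs) div 2 = Suc k" using xs(3)
        by (metis div_2_gt_zero gr0_implies_Suc less_one linorder_neqE_nat
            not_less_eq plus_1_eq_Suc zero_less_diff Suc_eq_plus1 less_diff_conv One_nat_def)
      then have k': "(n - length (xs @ [x]) - 1) div 2 = k" by auto
      from aw k have "alice_wins w g (Suc k) lo hi i (gain P Alice xs)" by simp
      then have right: "alice_wins w g k lo (hi + 2) i (gain P Alice xs + w (hi + 2)) \<or>
          0 < i \<and> alice_wins w g k (lo - 1) (hi + 1) (i - 1) (gain P Alice xs + w (lo - 1))"
        and left: "alice_wins w g k (lo - 2) hi i (gain P Alice xs + w (lo - 2)) \<or>
          0 < i \<and> alice_wins w g k (lo - 1) (hi + 1) (i - 1) (gain P Alice xs + w (hi + 1))"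
        by simp_all
      have ev': "even (length (xs @ [x]))" "length (xs @ [x]) \<noteq> n" using od False by auto
      from x' show ?thesis
      proof
        assume "x = idx n (hi + 1)"
        then have "good (xs @ [x]) lo (hi + 1) i" unfolding good_def k' using tk(1) ev' j right g jm
          by (auto simp: Let_def add.assoc simp del: length_append)
        then show ?thesis unfolding I_def by blast
      next
        assume "x = idx n (lo - 1)"
        then have "good (xs @ [x]) (lo - 1) hi i" unfolding good_def k' using tk(2) ev' j left g jm
          by (auto simp: Let_def diff_diff_eq simp del: length_append)
        then show ?thesis unfolding I_def by blast
      qed
    qed
  next
    fix xs assume c: "complete_play n xs" and "I xs"
    then have "length xs = n" "xs \<noteq> []" using n by (auto simp: complete_play_def)
    then show "jumps n Alice xs \<le> j \<and> g \<le> gain P Alice xs"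
      using \<open>I xs\<close> unfolding I_def good_def by (auto split: if_splits)
  qed
qed

text \<open>The converse serves the optimality proofs. As the length is odd, the play after Alice's
  first move splits into full rounds of Bob and Alice, and \<open>k = 0\<close> means a complete
  play.\<close>

lemma strategy_imp_alice_wins:
  assumes od: "odd (length P)"
    and js: "jump_strategy (length P) Alice j s" and hg: "has_gain P Alice s g"
  shows "\<exists>v < length P. alice_wins (slice P) g ((length P - 1) div 2) v v j (slice P v)"
proof -
  define n where "n = length P"
  have n: "0 < n" using od odd_pos unfolding n_def by blast
  define w where "w = slice P"
  have w: "w i = P ! idx n i" for i unfolding w_def slice_def n_def ..
  have valid: "legal_move n xs (s xs)"
    if "play n xs" "follows Alice s xs" "length xs < n" "even (length xs)" for xs
    using js that unfolding jump_strategy_def valid_strategy_def n_def by simp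
  \<comment> \<open>The first conjunct is needed because the subtraction in the jump budget is
    truncated.\<close>
  have claim: "jumps n Alice xs \<le> j \<and>
      alice_wins w g k lo hi (j - jumps n Alice xs) (gain P Alice xs)"
    if "play n xs" "follows Alice s xs" "length xs + 2 * k = n"
      "set xs = idx n ` {lo..hi}" "int (length xs) = hi - lo + 1" for xs k lo hi
    using that
  proof (induction k arbitrary: xs lo hi)
    case 0
    then show ?case
      using js hg unfolding jump_strategy_def has_gain_def complete_play_def n_def by simp
  next
    case (Suc k)
    have odx: "odd (length xs)" using Suc.prems(3) od unfolding n_def by presburger
    have "0 < int (length xs)" using odd_pos[OF odx] by simp
    then have len: "lo \<le> hi" "hi - lo + 1 < int n"
      using Suc.prems(3,5) by auto
    \<comment> \<open>The last free slice lies at both ends. The quantifier over \<open>lo''\<close>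
      and \<open>hi''\<close> therefore admits either description of the new interval.\<close>
    have round: "\<exists>x. (x = idx n (hi' + 1) \<or> x = idx n (lo' - 1)) \<and>
        (\<forall>lo'' hi''. lo'' = lo' \<and> hi'' = hi' + 1 \<and> x = idx n hi'' \<or>
            lo'' = lo' - 1 \<and> hi'' = hi' \<and> x = idx n lo'' \<longrightarrow>
          (let J = jumps n Alice xs + (if neighbor n b x then 0 else 1) in
            J \<le> j \<and> alice_wins w g k lo'' hi'' (j - J) (gain P Alice xs + P ! x)))"
      if b: "b = idx n (hi + 1) \<and> lo' = lo \<and> hi' = hi + 1 \<or>
             b = idx n (lo - 1) \<and> lo' = lo - 1 \<and> hi' = hi"
      for b lo' hi'
    proof -
      define ys where "ys = xs @ [b]"
      have "legal_move n xs b"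
        using legal_move_interval[OF n Suc.prems(4) len] b by blast
      then have "play n ys" unfolding ys_def using Suc.prems(1) by (simp add: play_snoc)
      moreover have "follows Alice s ys"
        unfolding ys_def using Suc.prems(2) odx by (simp add: follows_snoc)
      moreover have "length ys < n" "even (length ys)"
        unfolding ys_def using Suc.prems(3) odx by auto
      ultimately have x: "legal_move n ys (s ys)" and ys: "play n ys" "follows Alice s ys"
          "length ys < n" "even (length ys)"
        using valid by blast+
      have set_ys: "set ys = idx n ` {lo'..hi'}" "int (length ys) = hi' - lo' + 1"
        using b len(1) Suc.prems(5)
        by (elim disjE; simp add: ys_def Suc.prems(4) image_idx_snoc)+
      have len': "lo' \<le> hi'" "hi' - lo' + 1 < int n"
        using b len set_ys(2) ys(3) by auto
      have xx: "s ys = idx n (hi' + 1) \<or> s ys = idx n (lo' - 1)"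
        using legal_move_interval[OF n set_ys(1) len'] x by simp
      have "last ys = b" "ys \<noteq> []" "jumps n Alice ys = jumps n Alice xs"
          "gain P Alice ys = gain P Alice xs"
        unfolding ys_def using odx by (simp_all add: jumps_snoc gain_snoc)
      then have J: "jumps n Alice (ys @ [s ys]) =
            jumps n Alice xs + (if neighbor n b (s ys) then 0 else 1)"
          and G: "gain P Alice (ys @ [s ys]) = gain P Alice xs + P ! s ys"
        using ys(4) by (simp_all add: jumps_snoc gain_snoc)
      have "jumps n Alice (ys @ [s ys]) \<le> j \<and> alice_wins w g k lo'' hi''
          (j - jumps n Alice (ys @ [s ys])) (gain P Alice (ys @ [s ys]))"
        if "lo'' = lo' \<and> hi'' = hi' + 1 \<and> s ys = idx n hi'' \<or>
            lo'' = lo' - 1 \<and> hi'' = hi' \<and> s ys = idx n lo''" for lo'' hi''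
      proof (rule Suc.IH)
        show "play n (ys @ [s ys])" using ys x by (simp add: play_snoc)
        show "follows Alice s (ys @ [s ys])" using ys by (simp add: follows_snoc)
        show "length (ys @ [s ys]) + 2 * k = n" using Suc.prems(3) unfolding ys_def by simp
        show "set (ys @ [s ys]) = idx n ` {lo''..hi''}"
          using that len'(1) by (elim disjE; simp add: set_ys(1) image_idx_snoc)
        show "int (length (ys @ [s ys])) = hi'' - lo'' + 1"
          using that set_ys(2) by auto
      qed
      then show ?thesis
        unfolding J G Let_def using xx by (intro exI[of _ "s ys"]) blast
    qed
    have small: "hi - lo + 3 \<le> int n" using Suc.prems(3,5) by auto
    have nd: "\<not> int n dvd hi + 1 - (lo - 1 + 1)"
      using zdvd_imp_le[of "int n" "hi + 1 - (lo - 1 + 1)"] len small by auto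
    \<comment> \<open>A move to the opposite end can be adjacent to Bob's slice only if it takes the
      last free slice. It then counts as a shift and is described as one.\<close>
    have far: "neighbor n (idx n (hi + 1)) (idx n (lo - 1)) \<Longrightarrow> idx n (lo - 1) = idx n (hi + 2)"
      unfolding neighbor_idx[OF n] idx_eq_iff[OF n] using nd by (simp add: add.assoc)
    have far': "neighbor n (idx n (lo - 1)) (idx n (hi + 1)) \<Longrightarrow> idx n (hi + 1) = idx n (lo - 2)"
    proof -
      assume "neighbor n (idx n (lo - 1)) (idx n (hi + 1))"
      then have "int n dvd (lo - 1) - (hi + 1 + 1)"
        unfolding neighbor_idx[OF n] using nd by blast
      then have "int n dvd - ((lo - 1) - (hi + 1 + 1))" by (simp only: dvd_minus_iff)
      then show ?thesis unfolding idx_eq_iff[OF n] by (simp add: algebra_simps)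
    qed
    let ?J = "jumps n Alice xs"
    have near: "neighbor n (idx n (hi + 1)) (idx n (hi + 2))"
      "neighbor n (idx n (lo - 1)) (idx n (lo - 2))"
      unfolding neighbor_idx[OF n] by auto
    have h2: "hi + 1 + 1 = hi + 2" "lo - 1 - 1 = lo - 2" by simp_all
    have right: "?J \<le> j \<and> (alice_wins w g k lo (hi + 2) (j - ?J) (gain P Alice xs + w (hi + 2)) \<or>
        0 < j - ?J \<and> alice_wins w g k (lo - 1) (hi + 1) (j - ?J - 1) (gain P Alice xs + w (lo - 1)))"
    proof -
      obtain x where x: "x = idx n (hi + 2) \<or> x = idx n (lo - 1)" and
        F: "\<forall>lo'' hi''. lo'' = lo \<and> hi'' = hi + 2 \<and> x = idx n hi'' \<or>
              lo'' = lo - 1 \<and> hi'' = hi + 1 \<and> x = idx n lo'' \<longrightarrow>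
          (let J = ?J + (if neighbor n (idx n (hi + 1)) x then 0 else 1) in
            J \<le> j \<and> alice_wins w g k lo'' hi'' (j - J) (gain P Alice xs + P ! x))"
        using round[OF disjI1, OF conjI[OF refl conjI[OF refl refl]], unfolded h2] by blast
      show ?thesis
      proof (cases "x = idx n (hi + 2)")
        case True
        then show ?thesis using F[rule_format, of lo "hi + 2"] near by (simp add: w Let_def)
      next
        case False
        then have "\<not> neighbor n (idx n (hi + 1)) x" "x = idx n (lo - 1)" using far x by auto
        then show ?thesis using F[rule_format, of "lo - 1" "hi + 1"] by (simp add: w Let_def)
      qed
    qed
    have left: "?J \<le> j \<and> (alice_wins w g k (lo - 2) hi (j - ?J) (gain P Alice xs + w (lo - 2)) \<or>
        0 < j - ?J \<and> alice_wins w g k (lo - 1) (hi + 1) (j - ?J - 1) (gain P Alice xs + w (hi + 1)))"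
    proof -
      obtain x where x: "x = idx n (hi + 1) \<or> x = idx n (lo - 2)" and
        F: "\<forall>lo'' hi''. lo'' = lo - 1 \<and> hi'' = hi + 1 \<and> x = idx n hi'' \<or>
              lo'' = lo - 2 \<and> hi'' = hi \<and> x = idx n lo'' \<longrightarrow>
          (let J = ?J + (if neighbor n (idx n (lo - 1)) x then 0 else 1) in
            J \<le> j \<and> alice_wins w g k lo'' hi'' (j - J) (gain P Alice xs + P ! x))"
        using round[OF disjI2, OF conjI[OF refl conjI[OF refl refl]], unfolded h2] by blast
      show ?thesis
      proof (cases "x = idx n (lo - 2)")
        case True
        then show ?thesis using F[rule_format, of "lo - 2" hi] near by (simp add: w Let_def)
      next
        case False
        then have "\<not> neighbor n (idx n (lo - 1)) x" "x = idx n (hi + 1)" using far' x by auto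
        then show ?thesis using F[rule_format, of "lo - 1" "hi + 1"] by (simp add: w Let_def)
      qed
    qed
    show ?case using right left by simp
  qed
  let ?x = "s []"
  have x: "legal_move n [] ?x"
    using valid[of "[]"] n by (simp add: play_def follows_def)
  then have "?x < n" by (simp add: legal_move_def)
  have "alice_wins w g ((n - 1) div 2) (int ?x) (int ?x) (j - jumps n Alice [?x]) (gain P Alice [?x])"
  proof (rule claim[THEN conjunct2])
    show "play n [?x]" "follows Alice s [?x]"
      using x play_snoc[of n "[]" ?x] follows_snoc[of Alice s "[]" ?x]
      by (simp_all add: play_def follows_def)
    show "length [?x] + 2 * ((n - 1) div 2) = n" using od n unfolding n_def by auto
  qed (use \<open>?x < n\<close> in \<open>simp_all add: idx_of_nat\<close>)
  moreover have "gain P Alice [?x] = w (int ?x)" "jumps n Alice [?x] = 0"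
    using gain_snoc[of P Alice "[]" ?x] jumps_snoc[of n Alice "[]" ?x] \<open>?x < n\<close>
    by (auto simp: w gain_def jumps_def idx_of_nat)
  ultimately show ?thesis
    using \<open>?x < n\<close> unfolding n_def w_def by (intro exI[of _ ?x]) auto
qed

section \<open>Pizzas with an odd number of slices\<close>

lemma alice_wins_mono_jumps: "alice_wins w g k lo hi j a \<Longrightarrow> j \<le> j' \<Longrightarrow> alice_wins w g k lo hi j' a"
proof (induction k arbitrary: lo hi j j' a)
  case (Suc k)
  have "j - 1 \<le> j' - 1" "0 < j \<Longrightarrow> 0 < j'" using Suc.prems(2) by auto
  then show ?case
    using Suc.prems Suc.IH[of _ _ j _ j'] Suc.IH[of _ _ "j - 1" _ "j' - 1"] unfolding alice_wins.simps
    by blast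
qed simp

text \<open>Every reply of Alice is forced, so her slices depend only on the number \<open>l\<close>
  of Bob's moves to the left and not on their order.\<close>

lemma alice_wins_no_jump_iff:
  "alice_wins w g k lo hi 0 a \<longleftrightarrow> (\<forall>l \<le> k. g \<le> a + (\<Sum>i<k - l. w (hi + 2 + 2 * int i)) +
     (\<Sum>i<l. w (lo - 2 - 2 * int i)))"
proof (induction k arbitrary: lo hi a)
  case (Suc k)
  have R: "w (hi + 2) + (\<Sum>i<k - l. w (hi + 2 + 2 + 2 * int i)) =
      (\<Sum>i<Suc k - l. w (hi + 2 + 2 * int i))" if "l \<le> k" for l
    using that by (simp add: Suc_diff_le sum.lessThan_Suc_shift algebra_simps del: sum.lessThan_Suc)
  have L: "w (lo - 2) + (\<Sum>i<l. w (lo - 2 - 2 - 2 * int i)) = (\<Sum>i<Suc l. w (lo - 2 - 2 * int i))"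
    for l
    by (simp add: sum.lessThan_Suc_shift algebra_simps del: sum.lessThan_Suc)
  define F where "F l = a + (\<Sum>i<Suc k - l. w (hi + 2 + 2 * int i)) +
     (\<Sum>i<l. w (lo - 2 - 2 * int i))" for l
  have FR: "a + w (hi + 2) + (\<Sum>i<k - l. w (hi + 2 + 2 + 2 * int i)) +
      (\<Sum>i<l. w (lo - 2 - 2 * int i)) = F l" if "l \<le> k" for l
    using R[OF that] unfolding F_def by linarith
  have FL: "a + w (lo - 2) + (\<Sum>i<k - l. w (hi + 2 + 2 * int i)) +
      (\<Sum>i<l. w (lo - 2 - 2 - 2 * int i)) = F (Suc l)" for l
    using L[of l] unfolding F_def diff_Suc_Suc by linarith
  have "alice_wins w g (Suc k) lo hi 0 a \<longleftrightarrow> (\<forall>l\<le>k. g \<le> F l) \<and> (\<forall>l\<le>k. g \<le> F (Suc l))"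
    unfolding alice_wins.simps Suc FL using FR by auto
  also have "\<dots> \<longleftrightarrow> (\<forall>l\<le>Suc k. g \<le> F l)"
    by (metis Suc_le_mono le_Suc_eq old.nat.exhaust zero_le)
  finally show ?case unfolding F_def .
qed simp

text \<open>The slices within Alice's reach on each side are increments of one function
  \<open>S\<close>, so both sums telescope.\<close>

lemma alice_wins_no_jumpI:
  fixes S :: "int \<Rightarrow> real"
  assumes right: "\<And>i. w (hi + 2 + 2 * i) = S (q + i + 1) - S (q + i)"
    and left: "\<And>i. w (lo - 2 - 2 * i) = S (p - i) - S (p - i - 1)"
    and g: "\<And>l. 0 \<le> l \<Longrightarrow> l \<le> int k \<Longrightarrow> g \<le> a + (S (q + int k - l) - S q) + (S p - S (p - l))"
  shows "alice_wins w g k lo hi 0 a"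
proof -
  have R: "(\<Sum>i<r. w (hi + 2 + 2 * int i)) = S (q + int r) - S q" for r
    unfolding right by (induction r) (simp_all add: algebra_simps)
  have L: "(\<Sum>i<l. w (lo - 2 - 2 * int i)) = S p - S (p - int l)" for l
    unfolding left by (induction l) (simp_all add: algebra_simps)
  show ?thesis
    unfolding alice_wins_no_jump_iff R L using g[of "int l" for l]
    by (auto simp: of_nat_diff algebra_simps)
qed

lemma ex_prefix_sums:
  fixes u :: "int \<Rightarrow> real"
  assumes per: "\<And>i. u (i + n) = u i" and "0 \<le> n"
  shows "\<exists>S. (\<forall>t. S (t + 1) = S t + u t) \<and> (\<forall>t. S (t + n) = S t + (\<Sum>i\<in>{0..<n}. u i))"
proof -
  define S where "S t = (if 0 \<le> t then \<Sum>i\<in>{0..<t}. u i else - (\<Sum>i\<in>{t..<0}. u i))" for t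
  have step: "S (t + 1) = S t + u t" for t
  proof (cases "0 \<le> t")
    case True
    then have "{0..<t + 1} = insert t {0..<t}" by auto
    then show ?thesis using True unfolding S_def by simp
  next
    case False
    then have "{t..<0} = insert t {t + 1..<0}" by auto
    then show ?thesis using False unfolding S_def by auto
  qed
  have "S (t + n) - S t = S n" for t
  proof (induction t rule: int_induct[of _ 0])
    case base
    show ?case by (simp add: S_def)
  next
    case (step1 i)
    then show ?case using step[of i] step[of "i + n"] per[of i] by (simp add: algebra_simps)
  next
    case (step2 i)
    then show ?case using step[of "i - 1"] step[of "i - 1 + n"] per[of "i - 1"]
      by (simp add: algebra_simps)
  qed
  moreover have "S n = (\<Sum>i\<in>{0..<n}. u i)" using \<open>0 \<le> n\<close> by (simp add: S_def)
  ultimately show ?thesis using step by (intro exI[of _ S]) (auto simp: algebra_simps)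
qed

text \<open>
  In the application \<open>a, \<dots>, f\<close> are the arcs into which the half circles \<open>a + b + c\<close>, \<open>c + d + e\<close> and
  \<open>e + f + a\<close> cut the pizza.
\<close>

lemma three_arcs_infeasible:
  fixes a b c d e f g :: real
  assumes "0 \<le> a" "0 \<le> b" "0 \<le> c" "0 \<le> d" "0 \<le> e" "0 \<le> f"
    and g: "16 * g = 7 * a + 7 * b + 7 * c + 7 * d + 7 * e + 7 * f"
    and x: "a + b + c < g" and y: "c + d + e < g" and z: "e + f + a < g"
    and K: "K = min (c + d) (f + a)" "b + 2 * K < 2 * g" "3 * b + 4 * e + 8 * K < 8 * g"
    and L: "L = min (e + f) (b + c)" "d + 2 * L < 2 * g" "3 * d + 4 * a + 8 * L < 8 * g"
    and M: "M = min (a + b) (d + e)" "f + 2 * M < 2 * g" "3 * f + 4 * c + 8 * M < 8 * g"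
  shows False
proof -
  note K' = K(2,3) and L' = L(2,3) and M' = M(2,3)
  have "K = c + d \<or> K = f + a" "L = e + f \<or> L = b + c" "M = a + b \<or> M = d + e"
    using K(1) L(1) M(1) by linarith+
  then consider
      "K = c + d" "L = e + f" "M = a + b"
    | "K = f + a" "L = b + c" "M = d + e"
    | "K = c + d" "L = e + f" "M = d + e" | "K = c + d" "L = b + c" "M = a + b"
    | "K = c + d" "L = b + c" "M = d + e" | "K = f + a" "L = e + f" "M = a + b"
    | "K = f + a" "L = e + f" "M = d + e" | "K = f + a" "L = b + c" "M = a + b"
    by metis
  then show False
  proof cases
    \<comment> \<open>Cases 1 and 2 are the choices invariant under rotation. The last inequalities
      for \<open>K\<close>, \<open>L\<close> and \<open>M\<close> add up to
      \<open>11 * (b + d + f) + 12 * (a + c + e) < 24 * g\<close>, where \<open>24 * g\<close> is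
      only 10.5 times the sum of the arcs.\<close>
    case 1
    show False using 1 assms(1-6) g K'(2) L'(2) M'(2) by linarith
  next
    case 2
    show False using 2 assms(1-6) g K'(2) L'(2) M'(2) by linarith
  next
    \<comment> \<open>In cases 3 to 8 the facts are combined with weight 10 for the half circle, 4
      for the single inequality, and 3 and 1 for the pair. This gives every arc the coefficient 14,
      except for one with 18, against \<open>32 * g\<close>. Since \<open>32 * g\<close> is exactly
      14 times the sum of the arcs, \<open>7 / 16\<close> leaves no slack here.\<close>
    case 3
    show False using 3 \<open>0 \<le> c\<close> g x K'(1) L' by linarith
  next
    case 4
    show False using 4 \<open>0 \<le> a\<close> g z K' M'(1) by linarith
  next
    case 5
    show False using 5 \<open>0 \<le> e\<close> g z L' M'(1) by linarith
  next
    case 6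
    show False using 6 \<open>0 \<le> e\<close> g y L'(1) M' by linarith
  next
    case 7
    show False using 7 \<open>0 \<le> a\<close> g x K'(1) M' by linarith
  next
    case 8
    show False using 8 \<open>0 \<le> c\<close> g y K' L'(1) by linarith
  qed
qed

section \<open>The circular order of an odd pizza\<close>

text \<open>
  With \<open>n = 2 * m + 1\<close> slices the even integers represent every slice once modulo \<open>n\<close>. In this
  order consecutive slices of a player who never jumps are adjacent, and \<open>S\<close> are the prefix sums.
\<close>

locale odd_pizza =
  fixes w S :: "int \<Rightarrow> real" and m :: int and T g :: real
  assumes m_nonneg: "0 \<le> m"
    and w_nonneg: "\<And>i. 0 \<le> w i"
    and w_periodic: "\<And>i. w (i + (2 * m + 1)) = w i"
    and S_step: "\<And>t. S (t + 1) = S t + w (2 * t)"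
    and S_periodic: "\<And>t. S (t + (2 * m + 1)) = S t + T"
begin

lemma w_even: "w (2 * t) = S (t + 1) - S t"
  using S_step[of t] by simp

text \<open>Adding the odd length makes the index even: slice \<open>2 * t + 1\<close> is entry
  \<open>t + m + 1\<close> of the order, almost opposite to entry \<open>t\<close>.\<close>

lemma w_odd: "w (2 * t + 1) = S (t + m + 2) - S (t + m + 1)"
proof -
  have "w (2 * t + 1) = w (2 * (t + m + 1))"
    using w_periodic[of "2 * t + 1"] by (simp add: algebra_simps)
  then show ?thesis unfolding w_even by (simp add: algebra_simps)
qed

lemma S_mono: "s \<le> t \<Longrightarrow> S s \<le> S t"
proof (induction t rule: int_ge_induct)
  case (step i)
  then show ?case using S_step[of i] w_nonneg[of "2 * i"] by simp
qed simp

text \<open>Alice takes \<open>m + 1\<close> of the \<open>2 * m + 1\<close> slices, hence the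
  number of entries.\<close>

definition half :: "int \<Rightarrow> real" where
  "half h = S (h + m + 1) - S h"

lemma half_periodic: "half (h + (2 * m + 1)) = half h"
  using S_periodic[of h] S_periodic[of "h + m + 1"] unfolding half_def by (simp add: algebra_simps)

text \<open>If Bob moves left \<open>l\<close> times, the shifting Alice ends with the half circle
  at \<open>v - l\<close>, where \<open>0 \<le> l \<le> m\<close>.\<close>

lemma no_jump_wins:
  assumes "\<And>h. v - m \<le> h \<Longrightarrow> h \<le> v \<Longrightarrow> g \<le> half h"
  shows "alice_wins w g (nat m) (2 * v) (2 * v) j (w (2 * v))"
proof -
  have "alice_wins w g (nat m) (2 * v) (2 * v) 0 (w (2 * v))"
  proof (rule alice_wins_no_jumpI[where S = S and q = "v + 1" and p = v])
    show "w (2 * v + 2 + 2 * i) = S (v + 1 + i + 1) - S (v + 1 + i)" for i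
      using w_even[of "v + 1 + i"] by (simp add: algebra_simps)
    show "w (2 * v - 2 - 2 * i) = S (v - i) - S (v - i - 1)" for i
      using w_even[of "v - i - 1"] by (simp add: algebra_simps)
    show "g \<le> w (2 * v) + (S (v + 1 + int (nat m) - l) - S (v + 1)) + (S v - S (v - l))"
      if "0 \<le> l" "l \<le> int (nat m)" for l
      using assms[of "v - l"] that m_nonneg unfolding half_def w_even by (simp add: algebra_simps)
  qed
  then show ?thesis by (rule alice_wins_mono_jumps) simp
qed

section \<open>Strategies with one jump\<close>

text \<open>
  Let Alice own the slices \<open>s, \<dots>, t - 1\<close>, and let Bob have just played to the right (left) of them.
  Then \<open>jump_right s t\<close> (\<open>jump_left s t\<close>) says that jumping now gives her \<open>g\<close>.
\<close>

definition jump_right :: "int \<Rightarrow> int \<Rightarrow> bool" where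
  "jump_right s t \<longleftrightarrow>
     (\<forall>h. t \<le> h \<longrightarrow> h \<le> s + m \<longrightarrow> g \<le> S t - S s + half h - (S (t + m + 1) - S (s + m + 1)))"

definition jump_left :: "int \<Rightarrow> int \<Rightarrow> bool" where
  "jump_left s t \<longleftrightarrow>
     (\<forall>h. t \<le> h \<longrightarrow> h \<le> s + m \<longrightarrow> g \<le> S t - S s + half h - (S (t + m) - S (s + m)))"

text \<open>After the jump the entries \<open>s + m, \<dots>, t + m\<close> opposite to Alice's arc
  are taken. Her later shifts extend this block on both sides to the half circle at some
  \<open>h\<close>, so they bring \<open>half h\<close> minus the block.\<close>

lemma after_jump_wins:
  assumes k: "int k = m - (t - s)"
    and g: "\<And>h. t \<le> h \<Longrightarrow> h \<le> s + m \<Longrightarrow>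
      g \<le> a + half h - (S (t + m + 1) - S (s + m))"
  shows "alice_wins w g k (2 * s - 1) (2 * t - 1) 0 a"
proof (rule alice_wins_no_jumpI[where S = S and q = "t + m + 1" and p = "s + m"])
  show "w (2 * t - 1 + 2 + 2 * i) = S (t + m + 1 + i + 1) - S (t + m + 1 + i)" for i
    using w_odd[of "t + i"] by (simp add: algebra_simps)
  show "w (2 * s - 1 - 2 - 2 * i) = S (s + m - i) - S (s + m - i - 1)" for i
    using w_odd[of "s - 2 - i"] by (simp add: algebra_simps)
  show "g \<le> a + (S (t + m + 1 + int k - l) - S (t + m + 1)) + (S (s + m) - S (s + m - l))"
    if "0 \<le> l" "l \<le> int k" for l
  proof -
    have e: "s + m - l + m + 1 = t + m + 1 + int k - l" using k by simp
    show ?thesis using g[of "s + m - l"] that k unfolding half_def e by linarith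
  qed
qed

text \<open>
  Alice starts in the arc \<open>p, \<dots>, q - 1\<close>, follows Bob by shifts while she can stay inside it, and
  jumps when he first leaves it.
\<close>

lemma stay_then_jump_wins:
  assumes q: "q \<le> p + m"
    and R: "\<And>s. p \<le> s \<Longrightarrow> s \<le> v \<Longrightarrow> jump_right s q"
    and L: "\<And>t. v < t \<Longrightarrow> t \<le> q \<Longrightarrow> jump_left p t"
    and "p \<le> s" "s \<le> v" "v < t" "t \<le> q" "int k = m + 1 - (t - s)"
  shows "alice_wins w g k (2 * s) (2 * t - 2) 1 (S t - S s)"
  using assms(4-)
proof (induction k arbitrary: s t)
  case 0
  \<comment> \<open>No round left would mean \<open>t - s = m + 1\<close>, but the arc has at most
    \<open>m\<close> entries.\<close>
  then show ?case using q by simp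
next
  case (Suc k)
  have k: "int k = m - (t - s)" using Suc.prems by simp
  have *: "alice_wins w g k (2 * s) (2 * t) 1 (S t - S s + w (2 * t)) \<or>
      alice_wins w g k (2 * s - 1) (2 * t - 1) 0 (S t - S s + w (2 * s - 1))"
  proof (cases "t < q")
    case True
    then show ?thesis using Suc.IH[of s "t + 1"] Suc.prems by (simp add: w_even)
  next
    case False
    then have "jump_right s t" using R Suc.prems by simp
    then have "alice_wins w g k (2 * s - 1) (2 * t - 1) 0 (S t - S s + w (2 * s - 1))"
      using w_odd[of "s - 1"] by (intro after_jump_wins[OF k]) (auto simp: jump_right_def algebra_simps)
    then show ?thesis ..
  qed
  have **: "alice_wins w g k (2 * s - 2) (2 * t - 2) 1 (S t - S s + w (2 * s - 2)) \<or>
      alice_wins w g k (2 * s - 1) (2 * t - 1) 0 (S t - S s + w (2 * t - 1))"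
  proof (cases "p < s")
    case True
    then have "alice_wins w g k (2 * (s - 1)) (2 * t - 2) 1 (S t - S (s - 1))"
      by (intro Suc.IH) (use Suc.prems in auto)
    moreover have "S t - S (s - 1) = S t - S s + w (2 * s - 2)"
      using w_even[of "s - 1"] by (simp add: right_diff_distrib)
    ultimately show ?thesis by (simp add: right_diff_distrib)
  next
    case False
    then have "jump_left s t" using L[of t] Suc.prems by simp
    then have "alice_wins w g k (2 * s - 1) (2 * t - 1) 0 (S t - S s + w (2 * t - 1))"
      using w_odd[of "t - 1"] by (intro after_jump_wins[OF k]) (auto simp: jump_left_def algebra_simps)
    then show ?thesis ..
  qed
  show ?case using * ** by simp
qed

text \<open>Every start \<open>v\<close> in the arc loses through a failing jump to one side. If the
  jumps from the whole arc succeed, take the least \<open>s\<close> with a failing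
  \<open>jump_right s q\<close>. The start \<open>s - 1\<close> can then only lose through some
  \<open>jump_left p t\<close> with \<open>s \<le> t\<close>.\<close>

lemma no_win_arc:
  assumes lose: "\<And>v. \<not> alice_wins w g (nat m) (2 * v) (2 * v) 1 (w (2 * v))"
    and pq: "p < q" "q \<le> p + m"
  shows "\<not> jump_right p q \<or> \<not> jump_left p q \<or>
    (\<exists>s t. p < s \<and> s \<le> t \<and> t < q \<and> \<not> jump_right s q \<and> \<not> jump_left p t)"
proof (rule ccontr)
  assume c: "\<not> ?thesis"
  have v: "(\<exists>s. p \<le> s \<and> s \<le> v \<and> \<not> jump_right s q) \<or> (\<exists>t. v < t \<and> t \<le> q \<and> \<not> jump_left p t)"
    if "p \<le> v" "v < q" for v
  proof (rule ccontr)
    assume "\<not> ?thesis"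
    then have "alice_wins w g (nat m) (2 * v) (2 * (v + 1) - 2) 1 (S (v + 1) - S v)"
      using that m_nonneg by (intro stay_then_jump_wins[OF pq(2), of v]) auto
    then show False using lose[of v] by (simp add: w_even)
  qed
  have c': "jump_right p q" "jump_left p q"
    and c'': "\<And>s t. p < s \<Longrightarrow> s \<le> t \<Longrightarrow> t < q \<Longrightarrow> \<not> jump_right s q \<Longrightarrow> jump_left p t"
    using c by blast+
  define A where "A = {s \<in> {p..q - 1}. \<not> jump_right s q}"
  have "finite A" by (rule finite_subset[of _ "{p..q - 1}"]) (auto simp: A_def)
  have "A \<noteq> {}"
  proof
    assume "A = {}"
    then have "jump_right s q" if "p \<le> s" "s \<le> q - 1" for s using that unfolding A_def by auto
    then obtain t where "q - 1 < t" "t \<le> q" "\<not> jump_left p t" using v[of "q - 1"] pq(1) by auto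
    then have "t = q" by linarith
    then show False using c'(2) \<open>\<not> jump_left p t\<close> by simp
  qed
  define s where "s = Min A"
  have s: "p \<le> s" "s \<le> q - 1" "\<not> jump_right s q"
    using Min_in[OF \<open>finite A\<close> \<open>A \<noteq> {}\<close>] unfolding s_def A_def by auto
  have s_min: "jump_right s' q" if "p \<le> s'" "s' \<le> s - 1" for s'
  proof (rule ccontr)
    assume "\<not> jump_right s' q"
    then have "s' \<in> A" using that s unfolding A_def by simp
    then have "s \<le> s'" unfolding s_def using \<open>finite A\<close> by simp
    then show False using that by simp
  qed
  have "s \<noteq> p" using s(3) c'(1) by blast
  then have "p < s" using s(1) by simp
  then obtain t where t: "s - 1 < t" "t \<le> q" "\<not> jump_left p t"
    using v[of "s - 1"] s s_min by auto
  have "t \<noteq> q" using t(3) c'(2) by blast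
  then show False using c''[of s t] \<open>p < s\<close> t s(3) by simp
qed

section \<open>Light half circles that cover the pizza\<close>

text \<open>Each half circle starts no later than the last entry of its predecessor, also from
  \<open>z\<close> around to \<open>x + (2 * m + 1)\<close>. The conditions are thus invariant under
  rotation.\<close>

definition triple :: "int \<Rightarrow> int \<Rightarrow> int \<Rightarrow> bool" where
  "triple x y z \<longleftrightarrow> x < y \<and> y \<le> x + m \<and> y < z \<and> z \<le> y + m \<and> z \<le> x + 2 * m \<and> x + m < z \<and>
     half x < g \<and> half y < g \<and> half z < g"

lemma triple_rotate: "triple x y z \<Longrightarrow> triple y z (x + (2 * m + 1))"
  unfolding triple_def half_periodic by auto

text \<open>Greedy cover: from a light \<open>x\<close> go to the farthest light \<open>y\<close>
  within reach, and then to a light \<open>z\<close> after \<open>y\<close>. Maximality of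
  \<open>y\<close> puts \<open>z\<close> beyond \<open>x + m\<close>.\<close>

lemma ex_triple:
  assumes g: "2 * g \<le> T" and lose: "\<And>v. \<not> alice_wins w g (nat m) (2 * v) (2 * v) j (w (2 * v))"
  shows "\<exists>x y z. triple x y z"
proof -
  have window: "\<exists>h. v - m \<le> h \<and> h \<le> v \<and> half h < g" for v
    using no_jump_wins[of v j] lose[of v] by force
  \<comment> \<open>These two half circles together cover the pizza, so they cannot both be below
    \<open>g\<close>.\<close>
  have opposite: "\<not> (half h < g \<and> half (h + m + 1) < g)" for h
  proof -
    have "S h + T \<le> S (h + m + 1 + m + 1)"
      unfolding S_periodic[symmetric] by (rule S_mono) simp
    then show ?thesis using g unfolding half_def by linarith
  qed
  obtain x where x: "half x < g" using window by blast
  define Y where "Y = {h. x < h \<and> h \<le> x + m \<and> half h < g}"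
  have "finite Y" by (rule finite_subset[of _ "{x..x + m}"]) (auto simp: Y_def)
  have "Y \<noteq> {}"
  proof -
    obtain h where "x + m + 1 - m \<le> h" "h \<le> x + m + 1" "half h < g" using window by blast
    then have "h \<in> Y" using opposite[of x] x unfolding Y_def by (cases "h = x + m + 1") auto
    then show ?thesis by blast
  qed
  define y where "y = Max Y"
  have y: "x < y" "y \<le> x + m" "half y < g"
    using Max_in[OF \<open>finite Y\<close> \<open>Y \<noteq> {}\<close>] unfolding y_def Y_def by auto
  obtain z where z: "y + m + 1 - m \<le> z" "z \<le> y + m + 1" "half z < g" using window by blast
  have "z \<noteq> y + m + 1" using opposite[of y] y z by blast
  moreover have "x + m < z"
  proof (rule ccontr)
    assume "\<not> ?thesis"
    then have "z \<in> Y" using z y unfolding Y_def by auto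
    then have "z \<le> y" unfolding y_def using \<open>finite Y\<close> by simp
    then show False using z by simp
  qed
  ultimately have "triple x y z" using x y z unfolding triple_def by auto
  then show ?thesis by blast
qed

lemma triple_sum: "triple x y z \<Longrightarrow> T \<le> half x + half y + half z"
proof -
  assume t: "triple x y z"
  have "S y \<le> S (x + m + 1)" "S z \<le> S (y + m + 1)" "S x + T \<le> S (z + m + 1)"
    unfolding S_periodic[symmetric] by (rule S_mono; use t in \<open>simp add: triple_def\<close>)+
  then show ?thesis unfolding half_def by linarith
qed

text \<open>There are infinitely many integer triples, but by periodicity only finitely many sums,
  so a minimum exists.\<close>

lemma finite_range_half: "finite (range half)"
proof -
  have per: "half (h + (2 * m + 1) * k) = half h" for h k
  proof (induction k rule: int_induct[of _ 0])
    case (step1 i)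
    then show ?case using half_periodic[of "h + (2 * m + 1) * i"] by (simp add: algebra_simps)
  next
    case (step2 i)
    then show ?case using half_periodic[of "h + (2 * m + 1) * (i - 1)"] by (simp add: algebra_simps)
  qed simp
  have "half h \<in> half ` {0..<2 * m + 1}" for h
    using per[of "h mod (2 * m + 1)" "h div (2 * m + 1)"] m_nonneg
      pos_mod_sign[of "2 * m + 1" h] pos_mod_bound[of "2 * m + 1" h]
    by (intro image_eqI[of _ _ "h mod (2 * m + 1)"]) (auto simp: mod_mult_div_eq)
  then have "range half \<subseteq> half ` {0..<2 * m + 1}" by blast
  then show ?thesis by (rule finite_subset) simp
qed

lemma ex_min_triple:
  assumes "triple x0 y0 z0"
  shows "\<exists>x y z. triple x y z \<and>
    (\<forall>x' y' z'. triple x' y' z' \<longrightarrow> half x + half y + half z \<le> half x' + half y' + half z')"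
proof -
  define A where "A = {half x + half y + half z | x y z. triple x y z}"
  have "A \<subseteq> (\<lambda>(a, b, c). a + b + c) ` (range half \<times> range half \<times> range half)"
    unfolding A_def by force
  then have "finite A" by (rule finite_subset) (simp add: finite_range_half)
  moreover have "A \<noteq> {}" using assms unfolding A_def by blast
  ultimately have "Min A \<in> A" "\<And>a. a \<in> A \<Longrightarrow> Min A \<le> a" by auto
  then obtain x y z where xyz: "triple x y z" "Min A = half x + half y + half z"
    unfolding A_def by blast
  have "half x + half y + half z \<le> half x' + half y' + half z'" if "triple x' y' z'" for x' y' z'
  proof -
    have "half x' + half y' + half z' \<in> A" unfolding A_def using that by blast
    then show ?thesis using \<open>\<And>a. a \<in> A \<Longrightarrow> Min A \<le> a\<close> xyz(2) by metis
  qed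
  then show ?thesis using xyz(1) by blast
qed

text \<open>Otherwise \<open>h\<close> could replace \<open>y\<close> or \<open>z\<close> in the minimal triple.\<close>

lemma min_triple_half:
  assumes t: "triple x y z"
    and min: "\<And>x' y' z'. triple x' y' z' \<Longrightarrow> half x + half y + half z \<le> half x' + half y' + half z'"
    and h: "z - m \<le> h" "h \<le> y + m"
  shows "min (half y) (half z) \<le> half h"
proof (rule ccontr)
  assume "\<not> ?thesis"
  then have l: "half h < half y" "half h < half z" by auto
  show False
  proof (cases "h \<le> x + m")
    case True
    then have "triple x h z" using t h l unfolding triple_def by auto
    then show False using min l by fastforce
  next
    case False
    then have "triple x y h" using t h l unfolding triple_def by auto
    then show False using min l by fastforce
  qed
qed

text \<open>
  Here \<open>b\<close> is covered neither by the half circle at \<open>y\<close> nor by the one at \<open>z\<close>, and \<open>e\<close> is covered by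
  both. The arc \<open>b\<close> lies opposite to \<open>e\<close>: an Alice who owns a part of \<open>b\<close> and jumps loses only the
  corresponding part of \<open>e\<close> from a half circle that is worth at least \<open>K + e\<close>.
\<close>

lemma arc_bound:
  assumes lose: "\<And>v. \<not> alice_wins w g (nat m) (2 * v) (2 * v) 1 (w (2 * v))"
    and yz: "y < z" "z \<le> y + m"
    and heavy: "\<And>h. z - m \<le> h \<Longrightarrow> h \<le> y + m \<Longrightarrow> K + e \<le> half h"
    and e: "e = S (y + m + 1) - S z" and b: "b = S y - S (z - m)" and "K + e < g"
  shows "b + 2 * K < 2 * g" "3 * b + 4 * e + 8 * K < 8 * g"
proof -
  define p where "p = z - m"
  have z: "p + m = z" "p \<le> y" "y < p + m" using yz unfolding p_def by auto
  have "0 \<le> e" unfolding e using S_mono[of z "y + m + 1"] yz by simp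
  \<comment> \<open>A failing \<open>h\<close> lies between \<open>z - m\<close> and
    \<open>y + m\<close>, where \<open>heavy\<close> applies.\<close>
  have R: "S t - S s + e - (S (t + m + 1) - S (s + m + 1)) + K < g"
    if nj: "\<not> jump_right s t" and st: "p \<le> s" "s \<le> t" "t \<le> y" for s t
  proof -
    obtain h where h: "t \<le> h" "h \<le> s + m" "S t - S s + half h - (S (t + m + 1) - S (s + m + 1)) < g"
      using nj unfolding jump_right_def by force
    have "K + e \<le> half h" using st h by (intro heavy) (auto simp: p_def)
    then show ?thesis using h(3) by linarith
  qed
  have L: "S t - S s + e - (S (t + m) - S (s + m)) + K < g"
    if nj: "\<not> jump_left s t" and st: "p \<le> s" "s \<le> t" "t \<le> y" for s t
  proof -
    obtain h where h: "t \<le> h" "h \<le> s + m" "S t - S s + half h - (S (t + m) - S (s + m)) < g"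
      using nj unfolding jump_left_def by force
    have "K + e \<le> half h" using st h by (intro heavy) (auto simp: p_def)
    then show ?thesis using h(3) by linarith
  qed
  \<comment> \<open>This bound holds in all outcomes of \<open>no_win_arc\<close>. It is doubled
    because the third outcome adds two failures.\<close>
  have part: "S t - S s + 2 * e - 2 * (S (t + m + 1) - S (s + m)) + 2 * K < 2 * g"
    if st: "p \<le> s" "s < t" "t \<le> y" for s t
  proof -
    have mono: "S s \<le> S t" "S (s + m) \<le> S (s + m + 1)" "S (t + m) \<le> S (t + m + 1)"
      by (rule S_mono; use st in simp)+
    consider "\<not> jump_right s t" | "\<not> jump_left s t"
      | s' t' where "s < s'" "s' \<le> t'" "t' < t" "\<not> jump_right s' t" "\<not> jump_left s t'"
      using no_win_arc[OF lose, of s t] st z by force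
    then show ?thesis
    proof cases
      case 1
      then show ?thesis using R[of s t] st mono by simp
    next
      case 2
      then show ?thesis using L[of s t] st mono by simp
    next
      case 3
      have "S s' \<le> S t'" "S (s + m) \<le> S (s' + m + 1)" "S (t' + m) \<le> S (t + m + 1)"
        by (rule S_mono; use 3 in simp)+
      then show ?thesis using R[of s' t] L[of s t'] 3 st by simp
    qed
  qed
  have "b + 2 * K < 2 * g \<and> 3 * b + 4 * e + 8 * K < 8 * g"
  proof (cases "p = y")
    case True
    then show ?thesis using \<open>K + e < g\<close> \<open>0 \<le> e\<close> b by (simp add: p_def)
  next
    case False
    \<comment> \<open>From \<open>K < g\<close> follows
      \<open>3 * (b + K) + 4 * (K + e) + K < 8 * g\<close>.\<close>
    have small: ?thesis if "b + K < g"
      using that \<open>K + e < g\<close> \<open>0 \<le> e\<close> by linarith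
    have mono: "S z \<le> S (p + m + 1)" "S z \<le> S (y + m)" "S (y + m) \<le> S (y + m + 1)"
      by (rule S_mono; use z in simp)+
    consider "\<not> jump_right p y" | "\<not> jump_left p y"
      | s t where "p < s" "s \<le> t" "t < y" "\<not> jump_right s y" "\<not> jump_left p t"
      using no_win_arc[OF lose, of p y] False z by force
    then show ?thesis
    proof cases
      case 1
      then show ?thesis using R[of p y] z mono b e by (intro small) (simp add: p_def)
    next
      case 2
      then show ?thesis using L[of p y] z mono b e by (intro small) (simp add: p_def)
    next
      \<comment> \<open>The two failures alone give the first bound. For the second, they count
        twice and \<open>part\<close> is applied to the outer pieces from \<open>p\<close> to
        \<open>s\<close> and from \<open>t\<close> to \<open>y\<close>. The opposite pieces then add
        up to \<open>4 * e\<close>, which leaves \<open>4 * e\<close> of the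
        \<open>8 * e\<close>.\<close>
      case 3
      have "S s \<le> S t" "S z \<le> S (s + m + 1)" "S (t + m) \<le> S (y + m + 1)"
        by (rule S_mono; use 3 z in simp)+
      moreover have "S y - S s + e - (S (y + m + 1) - S (s + m + 1)) + K < g"
        using R[of s y] 3 by simp
      moreover have "S t - S p + e - (S (t + m) - S z) + K < g"
        using L[of p t] 3 z by simp
      moreover have "S y - S t + 2 * e - 2 * S (y + m + 1) + 2 * S (t + m) + 2 * K < 2 * g"
        using part[of t y] 3 by simp
      moreover have "S s - S p + 2 * e - 2 * S (s + m + 1) + 2 * S z + 2 * K < 2 * g"
        using part[of p s] 3 z by simp
      ultimately show ?thesis using b e unfolding p_def by linarith
    qed
  qed
  then show "b + 2 * K < 2 * g" "3 * b + 4 * e + 8 * K < 8 * g" by auto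
qed

section \<open>The two constants for odd pizzas\<close>

lemma zero_jump_third:
  assumes "3 * g = T"
  shows "\<exists>v. alice_wins w g (nat m) (2 * v) (2 * v) 0 (w (2 * v))"
proof (rule ccontr)
  assume "\<not> ?thesis"
  moreover have "0 \<le> T" using S_mono[of 0 "2 * m + 1"] S_periodic[of 0] m_nonneg by simp
  ultimately obtain x y z where t: "triple x y z" using ex_triple[of 0] assms by auto
  then show False using triple_sum[OF t] assms unfolding triple_def by linarith
qed

lemma one_jump_seven_sixteenths:
  assumes g: "16 * g = 7 * T"
  shows "\<exists>v. alice_wins w g (nat m) (2 * v) (2 * v) 1 (w (2 * v))"
proof (rule ccontr)
  assume "\<not> ?thesis"
  then have lose: "\<not> alice_wins w g (nat m) (2 * v) (2 * v) 1 (w (2 * v))" for v by blast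
  have "0 \<le> T" using S_mono[of 0 "2 * m + 1"] S_periodic[of 0] m_nonneg by simp
  then have "\<exists>x y z. triple x y z" using ex_triple[OF _ lose] g by auto
  then obtain x y z where t: "triple x y z"
    and min: "\<forall>x' y' z'. triple x' y' z' \<longrightarrow> half x + half y + half z \<le> half x' + half y' + half z'"
    using ex_min_triple by blast
  define n where "n = 2 * m + 1"
  have Sn: "S (i + n) = S i + T" for i unfolding n_def by (rule S_periodic)
  have half_n: "half (i + n) = half i" for i unfolding n_def by (rule half_periodic)
  have t2: "triple y z (x + n)" unfolding n_def by (rule triple_rotate[OF t])
  have t3: "triple z (x + n) (y + n)" unfolding n_def
    using triple_rotate[OF t2] by (simp add: n_def)
  have Sz: "S (z + m + 1) = S (z - m) + T" using Sn[of "z - m"] by (simp add: n_def algebra_simps)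
  have Sx: "S (x + n - m) = S (x + m + 1)" by (simp add: n_def algebra_simps)
  have Sy: "S (y + n - m) = S (y + m + 1)" by (simp add: n_def algebra_simps)
  have Sxn: "S (x + n + m + 1) = S (x + m + 1) + T" using Sn[of "x + m + 1"] by (simp add: algebra_simps)
  have m1: "min (half y) (half z) \<le> half h" if "z - m \<le> h" "h \<le> y + m" for h
    using min_triple_half[OF t _ that] min by blast
  have m2: "min (half z) (half (x + n)) \<le> half h" if "x + n - m \<le> h" "h \<le> z + m" for h
  proof (rule min_triple_half[OF t2 _ that])
    show "half y + half z + half (x + n) \<le> half x' + half y' + half z'" if "triple x' y' z'" for x' y' z'
      using min[rule_format, OF that] by (simp add: half_n)
  qed
  have m3: "min (half (x + n)) (half (y + n)) \<le> half h" if "y + n - m \<le> h" "h \<le> x + n + m" for h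
  proof (rule min_triple_half[OF t3 _ that])
    show "half z + half (x + n) + half (y + n) \<le> half x' + half y' + half z'"
      if "triple x' y' z'" for x' y' z'
      using min[rule_format, OF that] by (simp add: half_n)
  qed
  \<comment> \<open>The cut points are the starts and ends of the three half circles in circular
    order. The half circle at \<open>z\<close>, moved back by one turn, ends at
    \<open>z - m\<close>.\<close>
  define a where "a = S (z - m) - S x"
  define b where "b = S y - S (z - m)"
  define c where "c = S (x + m + 1) - S y"
  define d where "d = S z - S (x + m + 1)"
  define e where "e = S (y + m + 1) - S z"
  define f where "f = S x + T - S (y + m + 1)"
  note defs = a_def b_def c_def d_def e_def f_def
  have halves: "half x = a + b + c" "half y = c + d + e" "half z = e + f + a"
    unfolding half_def defs Sz by simp_all
  have light: "a + b + c < g" "c + d + e < g" "e + f + a < g"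
    using t unfolding triple_def halves by simp_all
  have "S x \<le> S (z - m)" "S (z - m) \<le> S y" "S y \<le> S (x + m + 1)" "S (x + m + 1) \<le> S z"
    "S z \<le> S (y + m + 1)" "S (y + m + 1) \<le> S (x + n)"
    by (rule S_mono; use t in \<open>simp add: triple_def n_def\<close>)+
  then have nonneg: "0 \<le> a" "0 \<le> b" "0 \<le> c" "0 \<le> d" "0 \<le> e" "0 \<le> f"
    unfolding defs Sn by simp_all
  \<comment> \<open>Taking the shared arc out of each minimum yields the form \<open>K + e\<close>
    of \<open>arc_bound\<close>.\<close>
  have mins: "min (half y) (half z) = min (c + d) (f + a) + e"
    "min (half z) (half (x + n)) = min (e + f) (b + c) + a"
    "min (half (x + n)) (half (y + n)) = min (a + b) (d + e) + c"
    unfolding half_n halves by (simp_all add: min_def)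
  have K: "b + 2 * min (c + d) (f + a) < 2 * g" "3 * b + 4 * e + 8 * min (c + d) (f + a) < 8 * g"
    using arc_bound[OF lose, of y z "min (c + d) (f + a)" e b] m1 t light
    unfolding mins triple_def by (simp_all add: e_def b_def)
  have L: "d + 2 * min (e + f) (b + c) < 2 * g" "3 * d + 4 * a + 8 * min (e + f) (b + c) < 8 * g"
    using arc_bound[OF lose, of z "x + n" "min (e + f) (b + c)" a d] m2 t2 light
    unfolding mins triple_def by (simp_all add: a_def d_def Sn Sz Sx)
  have M: "f + 2 * min (a + b) (d + e) < 2 * g" "3 * f + 4 * c + 8 * min (a + b) (d + e) < 8 * g"
    using arc_bound[OF lose, of "x + n" "y + n" "min (a + b) (d + e)" c f] m3 t3 light
    unfolding mins triple_def by (simp_all add: c_def f_def Sn Sy Sxn)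
  have "16 * g = 7 * a + 7 * b + 7 * c + 7 * d + 7 * e + 7 * f"
    using g unfolding defs by simp
  then show False
    by (rule three_arcs_infeasible[OF nonneg _ light refl K refl L refl M])
qed

end

section \<open>Gains\<close>

lemma slice_periodic: "slice P (i + int (length P)) = slice P i"
  unfolding slice_def idx_def by simp

lemma slice_nonneg: "cutting P \<Longrightarrow> 0 \<le> slice P i"
  unfolding slice_def cutting_def using idx_less[of "length P" i] by auto

text \<open>Doubling permutes the residues modulo an odd number.\<close>

lemma sum_even_slices:
  assumes "odd (length P)"
  shows "(\<Sum>i\<in>{0..<int (length P)}. slice P (2 * i)) = sum_list P"
proof -
  let ?n = "length P" and ?f = "\<lambda>i. idx (length P) (2 * i)"
  have n: "0 < ?n" using assms odd_pos by blast
  have "inj_on ?f {0..<int ?n}"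
  proof (rule inj_onI)
    fix i j assume ij: "i \<in> {0..<int ?n}" "j \<in> {0..<int ?n}" and "?f i = ?f j"
    then have "int ?n dvd 2 * (i - j)"
      unfolding idx_eq_iff[OF n] by (simp add: right_diff_distrib)
    moreover have "coprime (int ?n) 2" using assms by simp
    ultimately have "int ?n dvd i - j" using coprime_dvd_mult_right_iff by blast
    moreover have "\<bar>i - j\<bar> < int ?n" using ij by auto
    ultimately show "i = j" using dvd_imp_le_int[of "i - j" "int ?n"] by auto
  qed
  moreover from this have "?f ` {0..<int ?n} = {..<?n}"
    using idx_less[OF n] by (intro card_subset_eq) (auto simp: card_image)
  ultimately have "bij_betw ?f {0..<int ?n} {..<?n}" by (rule bij_betw_imageI)
  from sum.reindex_bij_betw[OF this, of "\<lambda>i. P ! i"] show ?thesis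
    unfolding slice_def by (simp add: sum_list_sum_nth atLeast0LessThan)
qed

lemma ex_odd_pizza:
  assumes P: "cutting P" and len: "length P = 2 * h + 1"
  shows "\<exists>S. odd_pizza (slice P) S (int h) (sum_list P)"
proof -
  have n: "int (length P) = 2 * int h + 1" using len by simp
  have "slice P (2 * (i + int (length P))) = slice P (2 * i)" for i
    using slice_periodic[of P "2 * i"] slice_periodic[of P "2 * i + int (length P)"]
    by (simp add: algebra_simps)
  then obtain S where S: "\<And>t. S (t + 1) = S t + slice P (2 * t)"
    "\<And>t. S (t + int (length P)) = S t + (\<Sum>i\<in>{0..<int (length P)}. slice P (2 * i))"
    using ex_prefix_sums[of "\<lambda>i. slice P (2 * i)" "int (length P)"] by auto
  have "odd (length P)" using len by simp
  then have "odd_pizza (slice P) S (int h) (sum_list P)"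
    using slice_nonneg[OF P] slice_periodic[of P] S sum_even_slices[of P]
    unfolding n by unfold_locales auto
  then show ?thesis by blast
qed

text \<open>Shifts keep Alice on one parity class, and she gets all of it. The heavier class is
  worth at least half of the pizza.\<close>

lemma even_no_jump_wins:
  assumes P: "cutting P" and len: "length P = 2 * h" and g: "2 * g \<le> sum_list P"
  shows "\<exists>v. alice_wins (slice P) g ((length P - 1) div 2) v v 0 (slice P v)"
proof -
  have h: "0 < h" using P len unfolding cutting_def by (cases h) auto
  define C where "C v = (\<Sum>i<h. slice P (v + 2 * int i))" for v
  have split: "(\<Sum>i<2 * h. F i) = (\<Sum>i<h. F (2 * i) + F (2 * i + 1))" for F :: "nat \<Rightarrow> real"
    by (induction h) simp_all
  have "sum_list P = (\<Sum>i<2 * h. slice P (int i))"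
    unfolding sum_list_sum_nth len atLeast0LessThan
    by (intro sum.cong) (simp_all add: slice_def idx_of_nat len)
  then have "sum_list P = C 0 + C 1"
    unfolding split C_def by (simp add: sum.distrib add.commute)
  then have "g \<le> C 0 \<or> g \<le> C 1" using g by linarith
  then obtain v where v: "g \<le> C v" by blast
  have "slice P (v + 2 * (i + int h)) = slice P (v + 2 * i)" for i
    using slice_periodic[of P "v + 2 * i"] len by (simp add: algebra_simps)
  then obtain S where S: "\<And>t. S (t + 1) = S t + slice P (v + 2 * t)"
    "\<And>t. S (t + int h) = S t + (\<Sum>i\<in>{0..<int h}. slice P (v + 2 * i))"
    using ex_prefix_sums[of "\<lambda>i. slice P (v + 2 * i)" "int h"] by auto
  have "(\<Sum>i\<in>{0..<int h}. slice P (v + 2 * i)) = C v"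
    using sum.atLeast_int_lessThan_int_shift[of "\<lambda>i. slice P (v + 2 * i)" 0 h]
    unfolding C_def by (simp add: atLeast0LessThan)
  then have Sh: "S (t + int h) = S t + C v" for t using S(2) by simp
  have "alice_wins (slice P) g (h - 1) v v 0 (slice P v)"
  proof (rule alice_wins_no_jumpI[where S = S and q = 1 and p = 0])
    show "slice P (v + 2 + 2 * i) = S (1 + i + 1) - S (1 + i)" for i
      using S(1)[of "1 + i"] by (simp add: algebra_simps)
    show "slice P (v - 2 - 2 * i) = S (0 - i) - S (0 - i - 1)" for i
      using S(1)[of "- i - 1"] by (simp add: algebra_simps)
    \<comment> \<open>Whatever \<open>l\<close> is, her slices are \<open>h\<close> consecutive
      entries, one period of the class.\<close>
    show "g \<le> slice P v + (S (1 + int (h - 1) - l) - S 1) + (S 0 - S (0 - l))" for l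
    proof -
      have "1 + int (h - 1) - l = - l + int h" using h by simp
      then show ?thesis using S(1)[of 0] Sh[of "- l"] v by simp
    qed
  qed
  moreover have "(length P - 1) div 2 = h - 1" using len by simp
  ultimately show ?thesis by (intro exI[of _ v]) simp
qed

lemma zero_jump_strategy:
  assumes P: "cutting P"
  shows "\<exists>s. jump_strategy (length P) Alice 0 s \<and> has_gain P Alice s (sum_list P / 3)"
proof -
  have nonneg: "0 \<le> sum_list P" using P unfolding cutting_def by (intro sum_list_nonneg) auto
  have "\<exists>v. alice_wins (slice P) (sum_list P / 3) ((length P - 1) div 2) v v 0 (slice P v)"
  proof (cases "even (length P)")
    case True
    then show ?thesis using even_no_jump_wins[OF P] nonneg by (auto elim!: evenE)
  next
    case False
    then obtain h where h: "length P = 2 * h + 1" by (rule oddE)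
    then obtain S where "odd_pizza (slice P) S (int h) (sum_list P)"
      using ex_odd_pizza[OF P] by blast
    from odd_pizza.zero_jump_third[OF this, of "sum_list P / 3"] show ?thesis
      using h by auto
  qed
  then show ?thesis using alice_wins_imp_strategy P unfolding cutting_def by blast
qed

lemma one_jump_strategy:
  assumes P: "cutting P"
  shows "\<exists>s. jump_strategy (length P) Alice 1 s \<and> has_gain P Alice s (7 * sum_list P / 16)"
proof -
  have nonneg: "0 \<le> sum_list P" using P unfolding cutting_def by (intro sum_list_nonneg) auto
  have "\<exists>v. alice_wins (slice P) (7 * sum_list P / 16) ((length P - 1) div 2) v v 1 (slice P v)"
  proof (cases "even (length P)")
    case True
    then have "\<exists>v. alice_wins (slice P) (7 * sum_list P / 16) ((length P - 1) div 2) v v 0 (slice P v)"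
      using even_no_jump_wins[OF P] nonneg by (auto elim!: evenE)
    then show ?thesis using alice_wins_mono_jumps by blast
  next
    case False
    then obtain h where h: "length P = 2 * h + 1" by (rule oddE)
    then obtain S where "odd_pizza (slice P) S (int h) (sum_list P)"
      using ex_odd_pizza[OF P] by blast
    from odd_pizza.one_jump_seven_sixteenths[OF this, of "7 * sum_list P / 16"] show ?thesis
      using h by auto
  qed
  then show ?thesis using alice_wins_imp_strategy P unfolding cutting_def by blast
qed

section \<open>Optimality\<close>

text \<open>Natural numbers make the search below executable.\<close>

definition size_at :: "nat list \<Rightarrow> int \<Rightarrow> nat" where
  "size_at ps i = ps ! nat (i mod int (length ps))"

text \<open>
  A search for a strategy of Bob that keeps Alice at \<open>c\<close> or less: for each of Alice's jumps it suffices
  to find the number \<open>l\<close> of Bob's later moves to the left, and Bob's replies are tried in turn.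
\<close>

definition bob_limits_no_jump :: "nat list \<Rightarrow> nat \<Rightarrow> nat \<Rightarrow> int \<Rightarrow> int \<Rightarrow> nat \<Rightarrow> bool" where
  "bob_limits_no_jump ps c k lo hi a \<longleftrightarrow> list_ex (\<lambda>l.
     a + sum_list (map (\<lambda>i. size_at ps (hi + 2 + 2 * int i)) [0..<k - l]) +
         sum_list (map (\<lambda>i. size_at ps (lo - 2 - 2 * int i)) [0..<l]) \<le> c) [0..<Suc k]"

fun bob_limits_one_jump :: "nat list \<Rightarrow> nat \<Rightarrow> nat \<Rightarrow> int \<Rightarrow> int \<Rightarrow> nat \<Rightarrow> bool" where
  "bob_limits_one_jump ps c 0 lo hi a \<longleftrightarrow> a \<le> c"
| "bob_limits_one_jump ps c (Suc k) lo hi a \<longleftrightarrow>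
     bob_limits_no_jump ps c k (lo - 1) (hi + 1) (a + size_at ps (lo - 1)) \<and>
       bob_limits_one_jump ps c k lo (hi + 2) (a + size_at ps (hi + 2)) \<or>
     bob_limits_no_jump ps c k (lo - 1) (hi + 1) (a + size_at ps (hi + 1)) \<and>
       bob_limits_one_jump ps c k (lo - 2) hi (a + size_at ps (lo - 2))"

lemma slice_map_real: "ps \<noteq> [] \<Longrightarrow> slice (map real ps) = (\<lambda>i. real (size_at ps i))"
  unfolding slice_def size_at_def using idx_less[of "length ps"] by (auto simp: idx_def)

lemma bob_limits_no_jump_sound:
  assumes "bob_limits_no_jump ps c k lo hi a" "ps \<noteq> []" "real c < g"
  shows "\<not> alice_wins (slice (map real ps)) g k lo hi 0 (real a)"
proof -
  obtain l where l: "l \<le> k" and "a + (\<Sum>i<k - l. size_at ps (hi + 2 + 2 * int i)) +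
      (\<Sum>i<l. size_at ps (lo - 2 - 2 * int i)) \<le> c"
    using assms(1) unfolding bob_limits_no_jump_def
    by (auto simp: list_ex_iff interv_sum_list_conv_sum_set_nat atLeast0LessThan less_Suc_eq_le
        simp del: upt_Suc)
  then have "real (a + (\<Sum>i<k - l. size_at ps (hi + 2 + 2 * int i)) +
      (\<Sum>i<l. size_at ps (lo - 2 - 2 * int i))) < g"
    using assms(3) by linarith
  then show ?thesis
    unfolding slice_map_real[OF assms(2)] alice_wins_no_jump_iff using l by (auto simp: not_le)
qed

text \<open>Each disjunct of the search is a reply of Bob. Its conjuncts bound Alice's jump, after
  which none is left, and her shift.\<close>

lemma bob_limits_one_jump_sound:
  assumes "bob_limits_one_jump ps c k lo hi a" "ps \<noteq> []" "real c < g"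
  shows "\<not> alice_wins (slice (map real ps)) g k lo hi 1 (real a)"
  using assms(1) unfolding slice_map_real[OF assms(2)]
proof (induction k arbitrary: lo hi a)
  case 0
  then show ?case using assms(3) by simp
next
  case (Suc k)
  note no_jump = bob_limits_no_jump_sound[OF _ assms(2,3), unfolded slice_map_real[OF assms(2)]]
  note sound = Suc.IH[of lo "hi + 2" "a + size_at ps (hi + 2)"]
    Suc.IH[of "lo - 2" hi "a + size_at ps (lo - 2)"]
    no_jump[of k "lo - 1" "hi + 1" "a + size_at ps (lo - 1)"]
    no_jump[of k "lo - 1" "hi + 1" "a + size_at ps (hi + 1)"]
  show ?case
    using Suc.prems sound by auto
qed

lemma zero_jump_third_optimal:
  assumes "1 / 3 < c"
  shows "\<exists>P. cutting P \<and>
    \<not> (\<exists>s. jump_strategy (length P) Alice 0 s \<and> has_gain P Alice s (c * sum_list P))"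
proof -
  \<comment> \<open>Three unit slices at equal distances; the search confirms for each first slice
    that Bob keeps Alice at 1 of 3.\<close>
  let ?ps = "[1, 0, 0, 1, 0, 0, 1, 0, 0] :: nat list"
  define P where "P = map real ?ps"
  have len: "length P = 9" "sum_list P = 3" and "cutting P"
    unfolding P_def cutting_def by simp_all
  have False if s: "jump_strategy (length P) Alice 0 s" "has_gain P Alice s (c * sum_list P)" for s
  proof -
    obtain v where "v < 9"
      and v: "alice_wins (slice P) (c * 3) 4 (int v) (int v) 0 (slice P v)"
      using strategy_imp_alice_wins[OF _ s] len by auto
    have "list_all (\<lambda>v. bob_limits_no_jump ?ps 1 4 (int v) (int v) (size_at ?ps (int v))) [0..<9]"
      by code_simp
    then have "bob_limits_no_jump ?ps 1 4 (int v) (int v) (size_at ?ps (int v))"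
      using \<open>v < 9\<close> by (simp only: list_all_iff set_upt atLeastLessThan_iff zero_le)
    from bob_limits_no_jump_sound[OF this, of "c * 3"] show False
      using v assms slice_map_real[of ?ps] unfolding P_def by simp
  qed
  then show ?thesis using \<open>cutting P\<close> by blast
qed

lemma one_jump_seven_sixteenths_optimal:
  assumes "7 / 16 < c"
  shows "\<exists>P. cutting P \<and>
    \<not> (\<exists>s. jump_strategy (length P) Alice 1 s \<and> has_gain P Alice s (c * sum_list P))"
proof -
  \<comment> \<open>The total is 16, and the search confirms the limit 7 for each first
    slice.\<close>
  let ?ps = "[3, 0, 0, 3, 0, 3, 0, 0, 1, 0, 1, 0, 0, 1, 0, 0, 1, 0, 1, 0, 0, 2, 0] :: nat list"
  define P where "P = map real ?ps"
  have len: "length P = 23" "sum_list P = 16" and "cutting P"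
    unfolding P_def cutting_def by simp_all
  have False if s: "jump_strategy (length P) Alice 1 s" "has_gain P Alice s (c * sum_list P)" for s
  proof -
    obtain v where "v < 23"
      and v: "alice_wins (slice P) (c * 16) 11 (int v) (int v) 1 (slice P v)"
      using strategy_imp_alice_wins[OF _ s] len by auto
    have "list_all (\<lambda>v. bob_limits_one_jump ?ps 7 11 (int v) (int v) (size_at ?ps (int v))) [0..<23]"
      by code_simp
    then have "bob_limits_one_jump ?ps 7 11 (int v) (int v) (size_at ?ps (int v))"
      using \<open>v < 23\<close> by (simp only: list_all_iff set_upt atLeastLessThan_iff zero_le)
    from bob_limits_one_jump_sound[OF this, of "c * 16"] show False
      using v assms slice_map_real[of ?ps] unfolding P_def by simp
  qed
  then show ?thesis using \<open>cutting P\<close> by blast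
qed

theorem theorem3:
  shows "(\<forall>P. cutting P \<longrightarrow>
            (\<exists>s. jump_strategy (length P) Alice 0 s \<and> has_gain P Alice s (sum_list P / 3)))
       \<and> (\<forall>c > 1 / 3. \<exists>P. cutting P \<and>
            \<not> (\<exists>s. jump_strategy (length P) Alice 0 s \<and> has_gain P Alice s (c * sum_list P)))
       \<and> (\<forall>P. cutting P \<longrightarrow>
            (\<exists>s. jump_strategy (length P) Alice 1 s \<and> has_gain P Alice s (7 * sum_list P / 16)))
       \<and> (\<forall>c > 7 / 16. \<exists>P. cutting P \<and>
            \<not> (\<exists>s. jump_strategy (length P) Alice 1 s \<and> has_gain P Alice s (c * sum_list P)))"
  using zero_jump_strategy zero_jump_third_optimal one_jump_strategy one_jump_seven_sixteenths_optimal
  by blast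

end
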